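(* Let $\tau:\mathbb{U}\to\Omega$, $\tau(z)=\frac{az+b}{cz+d}$, be a linear fractional Riemann map, let $\lambda\in\mathbb{C}\setminus\{0\}$, and let $\Phi$ and $\Phi_{\star}$ be analytic self-maps of $\Omega$ such that $C_{\Phi}$ and $C_{\Phi_{\star}}$ are bounded on $H^{2}(\Omega)$. Then $C_{\Phi}^{*}=\lambda C_{\Phi_{\star}}$ if and only if one of the following cases occurs: (1) $|c|^{2}=|d|^{2}$ and there is a complex number $r$ such that, for all $w\in\Omega$, $$\Phi(w)=\overline{\lambda}^{-1}w+r\quad\text{and}\quad \Phi_{\star}(w)=\lambda w+\frac{(\lambda-1)(|a|^{2}-|b|^{2})+\lambda\overline{r}(b\overline{d}-a\overline{c})}{\overline{b}d-\overline{a}c}.$$ (2) $|c|^{2}\neq|d|^{2}$, $(|a|^{2}-|b|^{2})(|c|^{2}-|d|^{2})=|b\overline{d}-a\overline{c}|^{2}$, and there is a complex number $r$ such that, for all $w\in\Omega$, $$\Phi(w)=rw+\frac{(r-1)(b\overline{d}-a\overline{c})}{|c|^{2}-|d|^{2}}\quad\text{and}\quad \Phi_{\star}(w)=\lambda\overline{r}w+\frac{(\lambda\overline{r}-1)(b\overline{d}-a\overline{c})}{|c|^{2}-|d|^{2}}.$$ (3) $|c|^{2}\neq|d|^{2}$, $(|a|^{2}-|b|^{2})(|c|^{2}-|d|^{2})\neq|b\overline{d}-a\overline{c}|^{2}$, $\lambda=1$, and there is $r\in\mathbb{C}$ such that, for all $w\in\Omega$, $$\Phi(w)=rw+\frac{(r-1)(b\overline{d}-a\overline{c})}{|c|^{2}-|d|^{2}}\quad\text{and}\quad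 \Phi_{\star}(w)=\overline{r}w+\frac{(\overline{r}-1)(b\overline{d}-a\overline{c})}{|c|^{2}-|d|^{2}}.$$
   Context: $\mathbb{U}$ is the open unit disc and $\Omega$ is an open simply connected proper subset of $\mathbb{C}$. A Riemann map $\tau:\mathbb{U}\to\Omega$ is a biholomorphic map of $\mathbb{U}$ onto $\Omega$; it is a linear fractional Riemann map if $\tau(z)=\frac{az+b}{cz+d}$ with $a,b,c,d\in\mathbb{C}$, $ad-bc\neq0$. The Hardy-Smirnov space $H^{2}(\Omega)$ is the set of analytic $f:\Omega\to\mathbb{C}$ with $\|f\|^{2}=\sup_{0<r<1}\frac{1}{2\pi}\int_{\Gamma_r}|f(w)|^{2}|dw|<\infty$, where $\Gamma_r=\tau(\{|z|=r\})$; the norm is the one induced by the given $\tau$. Fix an analytic branch of $(\tau')^{1/2}$ on $\mathbb{U}$. The map $Vf=(f\circ\tau)(\tau')^{1/2}$ is an isometric isomorphism from $H^2(\Omega)$ onto the classical Hardy space $H^2(\mathbb{U})$, and $H^{2}(\Omega)$ is a Hilbert space with inner product $\langle f,g\rangle=\langle Vf,Vg\rangle_{2}$, where $\langle\cdot,\cdot\rangle_2$ is the inner product of $H^2(\mathbb{U})$, $\langle F,G\rangle_2=\sum_{n\ge0}\widehat F(n)\overline{\widehat G(n)}$ (Maclaurin coefficients). For an analytic self-map $\Phi$ of $\Omega$, $C_{\Phi}f=f\circ\Phi$; $C_\Phi^*$ is the Hilbert space adjoint of $C_\Phi$ on $H^2(\Omega)$. *)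

theory Defs
  imports "HOL-Complex_Analysis.Complex_Analysis"
begin

definition riemann_map :: "(complex \<Rightarrow> complex) \<Rightarrow> complex set \<Rightarrow> bool" where
  "riemann_map \<tau> \<Omega> \<longleftrightarrow>
     \<tau> holomorphic_on ball 0 1 \<and> bij_betw \<tau> (ball 0 1) \<Omega> \<and>
     (\<exists>\<sigma>. \<sigma> holomorphic_on \<Omega> \<and> (\<forall>z\<in>ball 0 1. \<sigma> (\<tau> z) = z) \<and> (\<forall>w\<in>\<Omega>. \<tau> (\<sigma> w) = w))"

text \<open>
  The clause \<open>c * z + d \<noteq> 0\<close> is implicit in the formula for \<open>\<tau>\<close>; it is written out only because
  division is total in HOL.
\<close>
definition linear_fractional_riemann_map ::
    "(complex \<Rightarrow> complex) \<Rightarrow> complex set \<Rightarrow> complex \<Rightarrow> complex \<Rightarrow> complex \<Rightarrow> complex \<Rightarrow> bool" where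
  "linear_fractional_riemann_map \<tau> \<Omega> a b c d \<longleftrightarrow>
     riemann_map \<tau> \<Omega> \<and> a * d - b * c \<noteq> 0 \<and>
     (\<forall>z\<in>ball 0 1. c * z + d \<noteq> 0 \<and> \<tau> z = (a * z + b) / (c * z + d))"

definition arc_length_integral :: "(real \<Rightarrow> complex) \<Rightarrow> (complex \<Rightarrow> real) \<Rightarrow> real" where
  "arc_length_integral \<gamma> h =
     integral {0..1} (\<lambda>t. h (\<gamma> t) * norm (vector_derivative \<gamma> (at t within {0..1})))"

text \<open>
  A Riemann map is injective, so \<open>\<tau> \<circ> circlepath 0 r\<close> runs exactly once through the curve
  \<open>\<tau> ` sphere 0 r\<close>.
\<close>
definition hs_mean :: "(complex \<Rightarrow> complex) \<Rightarrow> (complex \<Rightarrow> complex) \<Rightarrow> real \<Rightarrow> real" where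
  "hs_mean \<tau> f r =
     1 / (2 * pi) * arc_length_integral (\<tau> \<circ> circlepath 0 r) (\<lambda>w. (norm (f w))\<^sup>2)"

text \<open>
  Elements of the Hardy--Smirnov space are represented by total functions, and only their values
  on \<open>\<Omega>\<close> matter: two representatives are the same element iff they agree on \<open>\<Omega>\<close>. Membership,
  norm and inner product below depend on nothing else.
\<close>
definition hardy_smirnov ::
    "(complex \<Rightarrow> complex) \<Rightarrow> complex set \<Rightarrow> (complex \<Rightarrow> complex) set" where
  "hardy_smirnov \<tau> \<Omega> = {f. f holomorphic_on \<Omega> \<and> bdd_above (hs_mean \<tau> f ` {0<..<1})}"

definition hs_norm :: "(complex \<Rightarrow> complex) \<Rightarrow> (complex \<Rightarrow> complex) \<Rightarrow> real" where
  "hs_norm \<tau> f = sqrt (SUP r\<in>{0<..<1}. hs_mean \<tau> f r)"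

definition maclaurin_coeff :: "(complex \<Rightarrow> complex) \<Rightarrow> nat \<Rightarrow> complex" where
  "maclaurin_coeff F n = (deriv ^^ n) F 0 / fact n"

definition hardy_inner :: "(complex \<Rightarrow> complex) \<Rightarrow> (complex \<Rightarrow> complex) \<Rightarrow> complex" where
  "hardy_inner F G = (\<Sum>n. maclaurin_coeff F n * cnj (maclaurin_coeff G n))"

definition sqrt_deriv_branch :: "(complex \<Rightarrow> complex) \<Rightarrow> (complex \<Rightarrow> complex) \<Rightarrow> bool" where
  "sqrt_deriv_branch \<tau> q \<longleftrightarrow>
     q holomorphic_on ball 0 1 \<and> (\<forall>z\<in>ball 0 1. (q z)\<^sup>2 = deriv \<tau> z)"

text \<open>In the following, \<open>q\<close> stands for the chosen branch of the square root of \<open>deriv \<tau>\<close>.\<close>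

definition hs_to_hardy ::
    "(complex \<Rightarrow> complex) \<Rightarrow> (complex \<Rightarrow> complex) \<Rightarrow> (complex \<Rightarrow> complex) \<Rightarrow> complex \<Rightarrow> complex" where
  "hs_to_hardy \<tau> q f = (\<lambda>z. f (\<tau> z) * q z)"

definition hs_inner ::
    "(complex \<Rightarrow> complex) \<Rightarrow> (complex \<Rightarrow> complex) \<Rightarrow> (complex \<Rightarrow> complex) \<Rightarrow> (complex \<Rightarrow> complex)
       \<Rightarrow> complex" where
  "hs_inner \<tau> q f g = hardy_inner (hs_to_hardy \<tau> q f) (hs_to_hardy \<tau> q g)"

definition composition_op ::
    "(complex \<Rightarrow> complex) \<Rightarrow> (complex \<Rightarrow> complex) \<Rightarrow> complex \<Rightarrow> complex" where
  "composition_op \<Phi> f = f \<circ> \<Phi>"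

definition composition_op_bounded ::
    "(complex \<Rightarrow> complex) \<Rightarrow> complex set \<Rightarrow> (complex \<Rightarrow> complex) \<Rightarrow> bool" where
  "composition_op_bounded \<tau> \<Omega> \<Phi> \<longleftrightarrow>
     (\<forall>f\<in>hardy_smirnov \<tau> \<Omega>. composition_op \<Phi> f \<in> hardy_smirnov \<tau> \<Omega>) \<and>
     (\<exists>B. \<forall>f\<in>hardy_smirnov \<tau> \<Omega>. hs_norm \<tau> (composition_op \<Phi> f) \<le> B * hs_norm \<tau> f)"

text \<open>
  \<open>is_hs_adjoint \<tau> q \<Omega> T S\<close> says that \<open>S\<close> is the Hilbert space adjoint of the bounded operator \<open>T\<close>,
  i.e. \<open>T\<^sup>* = S\<close>. It is a relation because operators act on representatives: \<open>S f\<close> is determined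
  by \<open>T\<close> and \<open>f\<close> on \<open>\<Omega>\<close> only.
\<close>
definition is_hs_adjoint ::
    "(complex \<Rightarrow> complex) \<Rightarrow> (complex \<Rightarrow> complex) \<Rightarrow> complex set \<Rightarrow>
     ((complex \<Rightarrow> complex) \<Rightarrow> complex \<Rightarrow> complex) \<Rightarrow> ((complex \<Rightarrow> complex) \<Rightarrow> complex \<Rightarrow> complex)
       \<Rightarrow> bool" where
  "is_hs_adjoint \<tau> q \<Omega> T S \<longleftrightarrow>
     (\<forall>g\<in>hardy_smirnov \<tau> \<Omega>. S g \<in> hardy_smirnov \<tau> \<Omega>) \<and>
     (\<forall>f\<in>hardy_smirnov \<tau> \<Omega>. \<forall>g\<in>hardy_smirnov \<tau> \<Omega>.
        hs_inner \<tau> q (T f) g = hs_inner \<tau> q f (S g))"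

end

theory Submission
  imports Defs
begin

text \<open>
  For a point \<open>u\<close> of \<open>\<Omega>\<close> let \<open>K u\<close> be the reproducing kernel of the Hardy--Smirnov space, i.e. the
  preimage of a multiple of the Szego kernel. Evaluating \<open>C\<^sub>\<Phi>\<^sup>* = \<lambda> C\<^sub>\<Psi>\<close> on kernels gives
  \<open>K w (\<Phi> u) = cnj \<lambda> * K (\<Psi> w) u\<close>, and conversely this identity suffices because a bounded linear
  functional vanishing on all kernels is zero. For a linear fractional Riemann map, \<open>K u w\<close> is a
  constant divided by the Hermitian form
  \<open>A + C * w * cnj u + cnj M * w + M * cnj u\<close> with \<open>A = |a|\<^sup>2 - |b|\<^sup>2\<close>, \<open>C = |c|\<^sup>2 - |d|\<^sup>2\<close>,
  \<open>M = b * cnj d - a * cnj c\<close>, so the identity becomes a functional equation for this form. It forces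
  \<open>\<Phi>\<close> and \<open>\<Psi>\<close> to be affine. Since \<open>A * C - |M|\<^sup>2 = - |a * d - b * c|\<^sup>2 \<noteq> 0\<close>, the second of the
  three cases never occurs.
\<close>

section \<open>Power series in the unit disc\<close>

lemma maclaurin_sums:
  assumes "F holomorphic_on ball 0 1" "z \<in> ball 0 1"
  shows "(\<lambda>n. maclaurin_coeff F n * z ^ n) sums F z"
  using holomorphic_power_series[OF assms] by (simp add: maclaurin_coeff_def)

text \<open>Convergence at the single point 1/2 already gives a positive radius of convergence, so
  \<open>a\<close> is the formal power series expansion of \<open>F\<close> at 0. The coefficient
  rules below are obtained by exhibiting a series in this way.\<close>

lemma maclaurin_coeff_unique:
  assumes "\<And>z. z \<in> ball 0 1 \<Longrightarrow> (\<lambda>n. a n * z ^ n) sums F z"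
  shows "maclaurin_coeff F = a"
proof -
  have "summable (\<lambda>n. a n * (1/2 :: complex) ^ n)"
    using assms[of "1/2"] by (simp add: sums_iff)
  hence "conv_radius a \<ge> norm (1/2 :: complex)"
    by (rule conv_radius_geI)
  hence "0 < fps_conv_radius (Abs_fps a)"
    by (simp add: fps_conv_radius_def) (metis ereal_less(2) less_le_trans half_gt_zero zero_less_one)
  moreover have "eventually (\<lambda>z. z \<in> ball (0::complex) 1) (nhds 0)"
    by (intro eventually_nhds_in_open) auto
  hence "eventually (\<lambda>z. eval_fps (Abs_fps a) z = F z) (nhds 0)"
    by eventually_elim (use assms in \<open>auto simp: eval_fps_def sums_iff\<close>)
  ultimately have "F has_fps_expansion Abs_fps a"
    by (simp add: has_fps_expansion_def)
  from fps_nth_fps_expansion[OF this] show ?thesis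
    by (auto simp: maclaurin_coeff_def fun_eq_iff)
qed

lemma maclaurin_coeff_cong:
  assumes "G holomorphic_on ball 0 1" "\<And>z. z \<in> ball 0 1 \<Longrightarrow> F z = G z"
  shows "maclaurin_coeff F = maclaurin_coeff G"
  using assms by (intro maclaurin_coeff_unique) (simp add: maclaurin_sums)

lemma maclaurin_coeff_add:
  assumes "F holomorphic_on ball 0 1" "G holomorphic_on ball 0 1"
  shows "maclaurin_coeff (\<lambda>z. F z + G z) = (\<lambda>n. maclaurin_coeff F n + maclaurin_coeff G n)"
  using assms by (intro maclaurin_coeff_unique) (simp add: ring_distribs sums_add maclaurin_sums)

lemma maclaurin_coeff_cmult:
  assumes "F holomorphic_on ball 0 1"
  shows "maclaurin_coeff (\<lambda>z. k * F z) = (\<lambda>n. k * maclaurin_coeff F n)"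
  using assms by (intro maclaurin_coeff_unique) (simp add: mult.assoc sums_mult maclaurin_sums)

text \<open>This is Cauchy's integral formula for the coefficients, since \<open>1 / u = cnj u / r\<^sup>2\<close> on the circle.\<close>
lemma has_integral_circle_cnj_power:
  assumes F: "F holomorphic_on ball 0 1" and r: "0 < r" "r < 1"
  shows "((\<lambda>t. F (circlepath 0 r t) * cnj (circlepath 0 r t) ^ n)
           has_integral (maclaurin_coeff F n * of_real r ^ (2 * n))) {0..1}"
proof -
  have "((\<lambda>u. F u / (u - 0) ^ Suc n) has_contour_integral
            (2 * pi * \<i>) / fact n * (deriv ^^ n) F 0) (circlepath 0 r)"
    by (intro Cauchy_has_contour_integral_higher_derivative_circlepath holomorphic_on_imp_continuous_on
          holomorphic_on_subset[OF F]) (use r in auto)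
  hence "((\<lambda>t. F (circlepath 0 r t) / circlepath 0 r t ^ Suc n *
             vector_derivative (circlepath 0 r) (at t within {0..1}))
            has_integral (2 * pi * \<i> * maclaurin_coeff F n)) {0..1}"
    by (simp add: has_contour_integral_def maclaurin_coeff_def)
  \<comment> \<open>Of the \<open>Suc n\<close> factors in the denominator, one cancels against the
    derivative of the parametrisation; \<open>of_real r ^ (2 * n)\<close> turns the other
    \<open>n\<close> into powers of the conjugate.\<close>
  from has_integral_mult_right[OF this, of "of_real r ^ (2 * n) / (2 * pi * \<i>)"]
  have "((\<lambda>t. of_real r ^ (2 * n) / (2 * pi * \<i>) * (F (circlepath 0 r t) / circlepath 0 r t ^ Suc n *
             vector_derivative (circlepath 0 r) (at t within {0..1})))
            has_integral (maclaurin_coeff F n * of_real r ^ (2 * n))) {0..1}"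
    by (simp add: field_simps)
  then show ?thesis
  proof (rule has_integral_eq[rotated])
    fix t :: real assume t: "t \<in> {0..1}"
    define u where "u = circlepath 0 r t"
    have u: "u = of_real r * exp (2 * pi * \<i> * t)"
      by (simp add: u_def circlepath)
    have "norm u = r" using r by (simp add: u norm_mult)
    hence uu: "u * cnj u = of_real r ^ 2"
      by (simp add: complex_norm_square[symmetric])
    have "u \<noteq> 0" using r u by simp
    have "vector_derivative (circlepath 0 r) (at t within {0..1}) = 2 * pi * \<i> * u"
      using t by (simp add: vector_derivative_circlepath01 u)
    moreover have "of_real r ^ (2 * n) = u ^ n * cnj u ^ n"
      by (simp add: power_mult uu[symmetric] power_mult_distrib)
    ultimately show "of_real r ^ (2 * n) / (2 * pi * \<i>) * (F (circlepath 0 r t) / circlepath 0 r t ^ Suc n *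
             vector_derivative (circlepath 0 r) (at t within {0..1})) =
        F (circlepath 0 r t) * cnj (circlepath 0 r t) ^ n"
      using \<open>u \<noteq> 0\<close> unfolding u_def[symmetric] by (simp add: field_simps)
  qed
qed

lemma uniform_limit_maclaurin:
  assumes F: "F holomorphic_on ball 0 1" and r: "r < 1"
  shows "uniform_limit (cball 0 r) (\<lambda>N z. \<Sum>n<N. maclaurin_coeff F n * z ^ n) F sequentially"
proof -
  have "conv_radius (maclaurin_coeff F) \<ge> norm (complex_of_real s)" if "0 \<le> s" "s < 1" for s
    by (rule conv_radius_geI) (use maclaurin_sums[OF F, of s] that in \<open>simp add: sums_iff\<close>)
  \<comment> \<open>This number lies strictly between \<open>r\<close> and 1; the maximum keeps it
    nonnegative for negative \<open>r\<close>.\<close>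
  from this[of "(max r 0 + 1) / 2"] have "ereal ((max r 0 + 1) / 2) \<le> conv_radius (maclaurin_coeff F)"
    using r by (simp add: max_def split: if_splits)
  moreover have "ereal r < ereal ((max r 0 + 1) / 2)"
    using r by (simp add: max_def)
  ultimately have "ereal r < conv_radius (maclaurin_coeff F)" by (rule less_le_trans[rotated])
  from powser_uniform_limit[OF this, of 0]
  have "uniform_limit (cball 0 r) (\<lambda>N z. \<Sum>n<N. maclaurin_coeff F n * z ^ n)
          (\<lambda>z. \<Sum>n. maclaurin_coeff F n * z ^ n) sequentially" by simp
  also have "?this \<longleftrightarrow> ?thesis"
    by (rule uniform_limit_cong') (use maclaurin_sums[OF F] r in \<open>auto simp: sums_iff\<close>)
  finally show ?thesis .
qed

text \<open>Parseval's identity on a circle. Only the conjugated factor of |F|^2 is expanded: its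
  partial sums converge uniformly on the circle, so integration is term by term, and each term is a
  Cauchy integral.\<close>

lemma circle_mean_sums:
  assumes F: "F holomorphic_on ball 0 1" and r: "0 < r" "r < 1"
  shows "(\<lambda>n. (cmod (maclaurin_coeff F n))\<^sup>2 * r ^ (2 * n)) sums
           integral {0..1} (\<lambda>t. (cmod (F (circlepath 0 r t)))\<^sup>2)"
proof -
  let ?a = "maclaurin_coeff F" and ?c = "circlepath 0 r"
  have cont: "continuous_on {0..1} (\<lambda>t. F (?c t))"
    by (rule continuous_on_compose2[OF holomorphic_on_imp_continuous_on[OF F]])
       (use r in \<open>auto simp: circlepath norm_mult intro!: continuous_intros\<close>)
  have contc: "continuous_on {0..1} ?c" by (simp add: circlepath continuous_intros)
  have "uniform_limit {0..1} (\<lambda>N t. \<Sum>n<N. ?a n * ?c t ^ n) (\<lambda>t. F (?c t)) sequentially"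
    by (rule uniform_limit_compose'[OF uniform_limit_maclaurin[OF F r(2)]])
       (use r in \<open>auto simp: circlepath norm_mult\<close>)
  hence "uniform_limit {0..1} (\<lambda>N t. cnj (\<Sum>n<N. ?a n * ?c t ^ n)) (\<lambda>t. cnj (F (?c t))) sequentially"
    by (rule bounded_linear.uniform_limit[OF bounded_linear_cnj])
  moreover have "bounded ((\<lambda>t. F (?c t)) ` {0..1})"
    by (intro compact_imp_bounded compact_continuous_image cont) auto
  moreover have "bounded ((\<lambda>t. cnj (F (?c t))) ` {0..1})"
    by (intro compact_imp_bounded compact_continuous_image continuous_intros cont) auto
  ultimately have lim: "uniform_limit {0..1} (\<lambda>N t. F (?c t) * cnj (\<Sum>n<N. ?a n * ?c t ^ n))
      (\<lambda>t. F (?c t) * cnj (F (?c t))) sequentially"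
    by (intro uniform_lim_mult uniform_limit_const)
  obtain I J where I: "\<And>N. ((\<lambda>t. F (?c t) * cnj (\<Sum>n<N. ?a n * ?c t ^ n)) has_integral I N) {0..1}"
    and J: "((\<lambda>t. F (?c t) * cnj (F (?c t))) has_integral J) {0..1}" and IJ: "I \<longlonglongrightarrow> J"
    by (rule uniform_limit_integral[OF lim]) (auto intro!: continuous_intros cont contc)
  have "((\<lambda>t. F (?c t) * cnj (\<Sum>n<N. ?a n * ?c t ^ n)) has_integral
          (\<Sum>n<N. cnj (?a n) * (?a n * of_real r ^ (2 * n)))) {0..1}" for N
  proof -
    have "((\<lambda>t. \<Sum>n<N. cnj (?a n) * (F (?c t) * cnj (?c t) ^ n)) has_integral
          (\<Sum>n<N. cnj (?a n) * (?a n * of_real r ^ (2 * n)))) {0..1}"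
      by (intro has_integral_sum has_integral_mult_right has_integral_circle_cnj_power F r) auto
    thus ?thesis by (simp add: sum_distrib_left mult_ac)
  qed
  hence "I N = (\<Sum>n<N. cnj (?a n) * (?a n * of_real r ^ (2 * n)))" for N
    using I has_integral_unique by blast
  moreover have "cnj x * (x * of_real r ^ k) = of_real ((cmod x)\<^sup>2 * r ^ k)" for x k
    using complex_norm_square[of x] by (simp add: mult_ac)
  ultimately have "I = (\<lambda>N. \<Sum>n<N. of_real ((cmod (?a n))\<^sup>2 * r ^ (2 * n)))"
    by (simp add: fun_eq_iff)
  with IJ have 1: "(\<lambda>n. complex_of_real ((cmod (?a n))\<^sup>2 * r ^ (2 * n))) sums J"
    by (simp add: sums_def)
  have 2: "(\<lambda>t. (cmod (F (?c t)))\<^sup>2) integrable_on {0..1}"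
    by (intro integrable_continuous_real continuous_intros cont)
  hence "((\<lambda>t. complex_of_real ((cmod (F (?c t)))\<^sup>2)) has_integral
           of_real (integral {0..1} (\<lambda>t. (cmod (F (?c t)))\<^sup>2))) {0..1}"
    by (intro has_integral_of_real) auto
  hence "J = of_real (integral {0..1} (\<lambda>t. (cmod (F (?c t)))\<^sup>2))"
    using J by (simp only: complex_norm_square has_integral_unique)
  with 1 show ?thesis by (simp only: sums_of_real_iff)
qed

section \<open>The Hardy--Smirnov space in terms of Maclaurin coefficients\<close>

locale hardy_smirnov_space =
  fixes \<tau> q :: "complex \<Rightarrow> complex" and \<Omega> :: "complex set"
  assumes riemann: "riemann_map \<tau> \<Omega>" and branch: "sqrt_deriv_branch \<tau> q"
begin

text \<open>\<open>riemann_map\<close> only asserts that some holomorphic inverse exists. This fixed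
  inverse agrees with it on \<Omega>, whence \<open>holomorphic_\<sigma>\<close>.\<close>

definition \<sigma> :: "complex \<Rightarrow> complex" where
  "\<sigma> = inv_into (ball 0 1) \<tau>"

definition hs_coeff :: "(complex \<Rightarrow> complex) \<Rightarrow> nat \<Rightarrow> complex" where
  "hs_coeff f = maclaurin_coeff (hs_to_hardy \<tau> q f)"

abbreviation "H \<equiv> hardy_smirnov \<tau> \<Omega>"

lemma holomorphic_\<tau>: "\<tau> holomorphic_on ball 0 1"
  and bij_\<tau>: "bij_betw \<tau> (ball 0 1) \<Omega>"
  using riemann by (auto simp: riemann_map_def)

lemma holomorphic_q: "q holomorphic_on ball 0 1"
  and q_square: "z \<in> ball 0 1 \<Longrightarrow> (q z)\<^sup>2 = deriv \<tau> z"
  using branch by (auto simp: sqrt_deriv_branch_def)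

lemma \<tau>_in: "z \<in> ball 0 1 \<Longrightarrow> \<tau> z \<in> \<Omega>"
  and \<sigma>_in: "w \<in> \<Omega> \<Longrightarrow> \<sigma> w \<in> ball 0 1"
  and \<sigma>_\<tau>: "z \<in> ball 0 1 \<Longrightarrow> \<sigma> (\<tau> z) = z"
  and \<tau>_\<sigma>: "w \<in> \<Omega> \<Longrightarrow> \<tau> (\<sigma> w) = w"
  using bij_betw_apply[OF bij_\<tau>] bij_betw_apply[OF bij_betw_inv_into[OF bij_\<tau>]]
    bij_betw_inv_into_left[OF bij_\<tau>] bij_betw_inv_into_right[OF bij_\<tau>]
  by (simp_all add: \<sigma>_def)

lemma norm_\<sigma>: "w \<in> \<Omega> \<Longrightarrow> norm (\<sigma> w) < 1"
  using \<sigma>_in by simp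

lemma holomorphic_\<sigma>: "\<sigma> holomorphic_on \<Omega>"
proof -
  obtain s where s: "s holomorphic_on \<Omega>" "\<And>z. z \<in> ball 0 1 \<Longrightarrow> s (\<tau> z) = z"
    using riemann unfolding riemann_map_def by blast
  have "\<sigma> w = s w" if "w \<in> \<Omega>" for w
    using s(2)[OF \<sigma>_in[OF that]] \<tau>_\<sigma>[OF that] by simp
  then show ?thesis using holomorphic_cong s(1) by blast
qed

text \<open>An injective holomorphic map has no critical points. This permits the division by
  \<open>q\<close> in \<open>hs_of_hardy\<close>.\<close>

lemma q_nonzero: "z \<in> ball 0 1 \<Longrightarrow> q z \<noteq> 0"
  using holomorphic_injective_imp_regular[OF holomorphic_\<tau>, of z] bij_\<tau> q_square[of z]
  by (auto simp: bij_betw_def)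

lemma holomorphic_hs_to_hardy:
  assumes "f holomorphic_on \<Omega>"
  shows "hs_to_hardy \<tau> q f holomorphic_on ball 0 1"
proof -
  have "(f \<circ> \<tau>) holomorphic_on ball 0 1"
    by (rule holomorphic_on_compose_gen[OF holomorphic_\<tau> assms]) (auto simp: \<tau>_in)
  then show ?thesis unfolding hs_to_hardy_def o_def
    by (intro holomorphic_on_mult holomorphic_q)
qed

lemma hs_to_hardy_at_\<sigma>: "w \<in> \<Omega> \<Longrightarrow> hs_to_hardy \<tau> q f (\<sigma> w) = f w * q (\<sigma> w)"
  by (simp add: hs_to_hardy_def \<tau>_\<sigma>)

text \<open>The arc length element of the image curve is 2 pi r |q|^2 dt, so the mean is
  \<open>r\<close> times the circle mean of the squared modulus of
  \<open>hs_to_hardy \<tau> q f\<close>. The extra \<open>r\<close> makes the exponent odd and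
  disappears as \<open>r\<close> tends to 1.\<close>

lemma hs_mean_sums:
  assumes f: "f holomorphic_on \<Omega>" and r: "0 < r" "r < 1"
  shows "(\<lambda>n. (cmod (hs_coeff f n))\<^sup>2 * r ^ (2 * n + 1)) sums hs_mean \<tau> f r"
proof -
  let ?c = "circlepath 0 r"
  have vd: "norm (vector_derivative (\<tau> \<circ> ?c) (at t within {0..1})) =
               2 * pi * r * (cmod (q (?c t)))\<^sup>2" if t: "t \<in> {0..1}" for t
  proof -
    have c: "?c t \<in> ball 0 1" using r by (simp add: circlepath norm_mult)
    have "(\<tau> has_field_derivative deriv \<tau> (?c t)) (at (?c t))"
      using holomorphic_derivI[OF holomorphic_\<tau> open_ball c] .
    hence "(\<tau> has_field_derivative (q (?c t))\<^sup>2) (at (?c t) within ?c ` {0..1})"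
      unfolding q_square[OF c] by (rule has_field_derivative_at_within)
    moreover have "(?c has_vector_derivative (2 * pi * \<i> * r * exp (2 * of_real pi * \<i> * t))) (at t within {0..1})"
      by (rule has_vector_derivative_circlepath)
    ultimately have "((\<tau> \<circ> ?c) has_vector_derivative
        (2 * pi * \<i> * r * exp (2 * of_real pi * \<i> * t)) * (q (?c t))\<^sup>2) (at t within {0..1})"
      by (intro field_vector_diff_chain_within)
    hence "vector_derivative (\<tau> \<circ> ?c) (at t within {0..1}) =
        (2 * pi * \<i> * r * exp (2 * of_real pi * \<i> * t)) * (q (?c t))\<^sup>2"
      using t by (intro vector_derivative_within_closed_interval) auto
    thus ?thesis using r by (simp add: norm_mult norm_power)
  qed
  have "hs_mean \<tau> f r = 1 / (2 * pi) *
      integral {0..1} (\<lambda>t. (2 * pi * r) * (cmod (hs_to_hardy \<tau> q f (?c t)))\<^sup>2)"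
    unfolding hs_mean_def arc_length_integral_def
    by (rule arg_cong[where f = "\<lambda>x. 1 / (2 * pi) * x"], rule integral_cong)
       (simp only: vd hs_to_hardy_def norm_mult power_mult_distrib o_apply mult_ac)
  also have "\<dots> = r * integral {0..1} (\<lambda>t. (cmod (hs_to_hardy \<tau> q f (?c t)))\<^sup>2)"
    by simp
  finally show ?thesis
    using sums_mult[OF circle_mean_sums[OF holomorphic_hs_to_hardy[OF f] r], of r]
    by (simp add: hs_coeff_def mult_ac)
qed

lemma hs_mean_le_suminf:
  assumes f: "f holomorphic_on \<Omega>" and s: "summable (\<lambda>n. (cmod (hs_coeff f n))\<^sup>2)"
    and r: "0 < r" "r < 1"
  shows "hs_mean \<tau> f r \<le> (\<Sum>n. (cmod (hs_coeff f n))\<^sup>2)"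
proof -
  have "(cmod (hs_coeff f n))\<^sup>2 * r ^ (2 * n + 1) \<le> (cmod (hs_coeff f n))\<^sup>2" for n
    using r power_le_one[of r "2 * n + 1"] by (intro mult_left_le) auto
  then show ?thesis
    using sums_le[OF _ hs_mean_sums[OF f r] summable_sums[OF s]] by blast
qed

text \<open>A finite partial sum is continuous in \<open>r\<close> up to \<open>r = 1\<close>, so
  the bound for \<open>r < 1\<close> survives the limit without any interchange with the infinite
  sum.\<close>

lemma sum_hs_coeff_le:
  assumes f: "f holomorphic_on \<Omega>" and S: "\<And>r. 0 < r \<Longrightarrow> r < 1 \<Longrightarrow> hs_mean \<tau> f r \<le> S"
  shows "(\<Sum>n<N. (cmod (hs_coeff f n))\<^sup>2) \<le> S"
proof -
  let ?p = "\<lambda>r. \<Sum>n<N. (cmod (hs_coeff f n))\<^sup>2 * r ^ (2 * n + 1)"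
  have "(?p \<longlongrightarrow> ?p 1) (at_left (1::real))"
    by (intro tendsto_intros)
  moreover have "eventually (\<lambda>r. ?p r \<le> S) (at_left (1::real))"
  proof -
    have "?p r \<le> S" if r: "0 < r" "r < 1" for r
    proof -
      have "?p r \<le> hs_mean \<tau> f r"
        using hs_mean_sums[OF f r] r by (intro sum_le_suminf[of _ "{..<N}", THEN order_trans]) (auto simp: sums_iff)
      then show ?thesis using S[OF r] by linarith
    qed
    then show ?thesis by (intro eventually_at_leftI[of 0]) auto
  qed
  ultimately have "?p 1 \<le> S"
    by (rule tendsto_upperbound) simp
  then show ?thesis by simp
qed

text \<open>Together with \<open>hs_norm_eq\<close> this places the space isometrically among the
  square summable sequences, after which the curve integrals no longer occur.\<close>

lemma hardy_smirnov_iff: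
  "f \<in> H \<longleftrightarrow> f holomorphic_on \<Omega> \<and> summable (\<lambda>n. (cmod (hs_coeff f n))\<^sup>2)"
proof (intro iffI conjI)
  assume f: "f \<in> H"
  then show h: "f holomorphic_on \<Omega>" by (simp add: hardy_smirnov_def)
  obtain S where "\<And>r. 0 < r \<Longrightarrow> r < 1 \<Longrightarrow> hs_mean \<tau> f r \<le> S"
    using f by (fastforce simp: hardy_smirnov_def bdd_above_def)
  from sum_hs_coeff_le[OF h this] show "summable (\<lambda>n. (cmod (hs_coeff f n))\<^sup>2)"
    by (intro bounded_imp_summable[of _ S]) (auto simp flip: lessThan_Suc_atMost simp del: sum.lessThan_Suc)
next
  assume "f holomorphic_on \<Omega> \<and> summable (\<lambda>n. (cmod (hs_coeff f n))\<^sup>2)"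
  with hs_mean_le_suminf[of f] show "f \<in> H"
    unfolding hardy_smirnov_def by (auto intro!: bdd_aboveI2)
qed

lemma holomorphic_H: "f \<in> H \<Longrightarrow> f holomorphic_on \<Omega>"
  and summable_H: "f \<in> H \<Longrightarrow> summable (\<lambda>n. (cmod (hs_coeff f n))\<^sup>2)"
  by (auto simp: hardy_smirnov_iff)

lemma hs_norm_eq:
  assumes f: "f \<in> H"
  shows "hs_norm \<tau> f = sqrt (\<Sum>n. (cmod (hs_coeff f n))\<^sup>2)"
proof -
  note h = holomorphic_H[OF f] and s = summable_H[OF f]
  have "(SUP r\<in>{0<..<1}. hs_mean \<tau> f r) = (\<Sum>n. (cmod (hs_coeff f n))\<^sup>2)"
  proof (rule cSup_eq_non_empty)
    show "hs_mean \<tau> f ` {0<..<1} \<noteq> {}" by simp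
    show "x \<le> (\<Sum>n. (cmod (hs_coeff f n))\<^sup>2)" if "x \<in> hs_mean \<tau> f ` {0<..<1}" for x
      using that hs_mean_le_suminf[OF h s] by auto
    show "(\<Sum>n. (cmod (hs_coeff f n))\<^sup>2) \<le> S" if "\<And>x. x \<in> hs_mean \<tau> f ` {0<..<1} \<Longrightarrow> x \<le> S" for S
      using that by (intro suminf_le_const s sum_hs_coeff_le h) auto
  qed
  then show ?thesis by (simp add: hs_norm_def)
qed

lemma hs_norm_nonneg: "f \<in> H \<Longrightarrow> 0 \<le> hs_norm \<tau> f"
  by (simp add: hs_norm_eq suminf_nonneg summable_H)

section \<open>Linear structure and inner product\<close>

lemma hs_coeff_add:
  assumes "f holomorphic_on \<Omega>" "g holomorphic_on \<Omega>"
  shows "hs_coeff (\<lambda>w. f w + g w) = (\<lambda>n. hs_coeff f n + hs_coeff g n)"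
  using maclaurin_coeff_add[OF assms[THEN holomorphic_hs_to_hardy]]
  by (simp add: hs_coeff_def hs_to_hardy_def ring_distribs)

lemma hs_coeff_cmult:
  assumes "f holomorphic_on \<Omega>"
  shows "hs_coeff (\<lambda>w. k * f w) = (\<lambda>n. k * hs_coeff f n)"
  using maclaurin_coeff_cmult[OF holomorphic_hs_to_hardy[OF assms], of k]
  by (simp add: hs_coeff_def hs_to_hardy_def mult.assoc)

lemma hs_coeff_cong:
  assumes "g holomorphic_on \<Omega>" "\<And>w. w \<in> \<Omega> \<Longrightarrow> f w = g w"
  shows "hs_coeff f = hs_coeff g"
  unfolding hs_coeff_def
  by (rule maclaurin_coeff_cong[OF holomorphic_hs_to_hardy[OF assms(1)]])
     (simp add: hs_to_hardy_def assms(2) \<tau>_in)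

lemma H_cmult:
  assumes f: "f \<in> H"
  shows "(\<lambda>w. k * f w) \<in> H"
proof -
  have "summable (\<lambda>n. (cmod (k * hs_coeff f n))\<^sup>2)"
    using summable_mult[OF summable_H[OF f], of "(cmod k)\<^sup>2"] by (simp only: norm_mult power_mult_distrib)
  then show ?thesis using holomorphic_H[OF f]
    by (simp add: hardy_smirnov_iff hs_coeff_cmult holomorphic_on_mult)
qed

lemma H_add:
  assumes f: "f \<in> H" and g: "g \<in> H"
  shows "(\<lambda>w. f w + g w) \<in> H"
proof -
  have "(cmod (x + y))\<^sup>2 \<le> 2 * ((cmod x)\<^sup>2 + (cmod y)\<^sup>2)" for x y
  proof -
    have "(cmod (x + y))\<^sup>2 \<le> (cmod x + cmod y)\<^sup>2"
      by (intro power_mono norm_triangle_ineq) auto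
    also have "\<dots> \<le> 2 * ((cmod x)\<^sup>2 + (cmod y)\<^sup>2)"
      using sum_squares_bound[of "cmod x" "cmod y"] by (simp add: power2_sum)
    finally show ?thesis .
  qed
  then have "summable (\<lambda>n. (cmod (hs_coeff f n + hs_coeff g n))\<^sup>2)"
    by (intro summable_comparison_test'[OF summable_mult[OF summable_add[OF summable_H[OF f] summable_H[OF g]], of 2], of 0])
       auto
  then show ?thesis using holomorphic_H[OF f] holomorphic_H[OF g]
    by (simp add: hardy_smirnov_iff hs_coeff_add holomorphic_on_add)
qed

lemma hs_inner_eq: "hs_inner \<tau> q f g = (\<Sum>n. hs_coeff f n * cnj (hs_coeff g n))"
  by (simp add: hs_inner_def hardy_inner_def hs_coeff_def)

text \<open>Cauchy-Schwarz for finite sums. The bound is uniform in \<open>N\<close>, so it yields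
  both the absolute convergence of the inner product series and
  \<open>norm_hs_inner_le\<close>.\<close>

lemma sum_norm_hs_coeff_le:
  assumes f: "f \<in> H" and g: "g \<in> H"
  shows "(\<Sum>n<N. norm (hs_coeff f n * cnj (hs_coeff g n))) \<le> hs_norm \<tau> f * hs_norm \<tau> g"
proof -
  have *: "L2_set (\<lambda>n. cmod (hs_coeff h n)) {..<N} \<le> hs_norm \<tau> h" if "h \<in> H" for h
    unfolding L2_set_def hs_norm_eq[OF that]
    by (intro real_sqrt_le_mono sum_le_suminf summable_H that) auto
  have "(\<Sum>n<N. norm (hs_coeff f n * cnj (hs_coeff g n)))
       \<le> L2_set (\<lambda>n. cmod (hs_coeff f n)) {..<N} * L2_set (\<lambda>n. cmod (hs_coeff g n)) {..<N}"
    using L2_set_mult_ineq[of "\<lambda>n. cmod (hs_coeff f n)" "\<lambda>n. cmod (hs_coeff g n)" "{..<N}"]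
    by (simp add: norm_mult)
  also have "\<dots> \<le> hs_norm \<tau> f * hs_norm \<tau> g"
    by (intro mult_mono * f g L2_set_nonneg hs_norm_nonneg)
  finally show ?thesis .
qed

lemma summable_norm_hs_inner:
  assumes "f \<in> H" "g \<in> H"
  shows "summable (\<lambda>n. norm (hs_coeff f n * cnj (hs_coeff g n)))"
  using sum_norm_hs_coeff_le[OF assms]
  by (intro bounded_imp_summable[of _ "hs_norm \<tau> f * hs_norm \<tau> g"])
     (auto simp flip: lessThan_Suc_atMost simp del: sum.lessThan_Suc)

lemma hs_inner_sums:
  assumes "f \<in> H" "g \<in> H"
  shows "(\<lambda>n. hs_coeff f n * cnj (hs_coeff g n)) sums hs_inner \<tau> q f g"
  unfolding hs_inner_eq
  by (rule summable_sums[OF summable_norm_cancel[OF summable_norm_hs_inner[OF assms]]])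

lemma norm_hs_inner_le:
  assumes "f \<in> H" "g \<in> H"
  shows "norm (hs_inner \<tau> q f g) \<le> hs_norm \<tau> f * hs_norm \<tau> g"
proof -
  have "norm (hs_inner \<tau> q f g) \<le> (\<Sum>n. norm (hs_coeff f n * cnj (hs_coeff g n)))"
    unfolding hs_inner_eq by (rule summable_norm[OF summable_norm_hs_inner[OF assms]])
  also have "\<dots> \<le> hs_norm \<tau> f * hs_norm \<tau> g"
    by (rule suminf_le_const[OF summable_norm_hs_inner[OF assms] sum_norm_hs_coeff_le[OF assms]])
  finally show ?thesis .
qed

lemma hs_inner_add_left:
  assumes "f \<in> H" "g \<in> H" "h \<in> H"
  shows "hs_inner \<tau> q (\<lambda>w. f w + g w) h = hs_inner \<tau> q f h + hs_inner \<tau> q g h"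
proof (rule sums_unique2)
  show "(\<lambda>n. hs_coeff (\<lambda>w. f w + g w) n * cnj (hs_coeff h n)) sums hs_inner \<tau> q (\<lambda>w. f w + g w) h"
    by (intro hs_inner_sums H_add assms)
  show "(\<lambda>n. hs_coeff (\<lambda>w. f w + g w) n * cnj (hs_coeff h n)) sums (hs_inner \<tau> q f h + hs_inner \<tau> q g h)"
    using sums_add[OF hs_inner_sums[OF assms(1,3)] hs_inner_sums[OF assms(2,3)]] assms
    by (simp add: hs_coeff_add holomorphic_H ring_distribs)
qed

lemma hs_inner_cmult_left:
  assumes "f \<in> H" "h \<in> H"
  shows "hs_inner \<tau> q (\<lambda>w. k * f w) h = k * hs_inner \<tau> q f h"
proof (rule sums_unique2)
  show "(\<lambda>n. hs_coeff (\<lambda>w. k * f w) n * cnj (hs_coeff h n)) sums hs_inner \<tau> q (\<lambda>w. k * f w) h"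
    by (intro hs_inner_sums H_cmult assms)
  show "(\<lambda>n. hs_coeff (\<lambda>w. k * f w) n * cnj (hs_coeff h n)) sums (k * hs_inner \<tau> q f h)"
    using sums_mult[OF hs_inner_sums[OF assms], of k] assms
    by (simp add: hs_coeff_cmult holomorphic_H mult.assoc)
qed

lemma hs_inner_commute:
  assumes "f \<in> H" "g \<in> H"
  shows "hs_inner \<tau> q g f = cnj (hs_inner \<tau> q f g)"
proof (rule sums_unique2)
  show "(\<lambda>n. hs_coeff g n * cnj (hs_coeff f n)) sums hs_inner \<tau> q g f"
    by (rule hs_inner_sums[OF assms(2,1)])
  have "(\<lambda>n. cnj (hs_coeff f n * cnj (hs_coeff g n))) sums cnj (hs_inner \<tau> q f g)"
    by (subst sums_cnj) (rule hs_inner_sums[OF assms])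
  then show "(\<lambda>n. hs_coeff g n * cnj (hs_coeff f n)) sums cnj (hs_inner \<tau> q f g)"
    by (simp only: complex_cnj_mult complex_cnj_cnj mult.commute)
qed

text \<open>Kernel identities hold only on \<Omega>, not as equalities of total functions; this
  makes them usable inside the inner product.\<close>

lemma hs_inner_cong_left:
  assumes "g \<in> H" "\<And>w. w \<in> \<Omega> \<Longrightarrow> f w = g w"
  shows "hs_inner \<tau> q f h = hs_inner \<tau> q g h"
proof -
  have "hs_coeff f = hs_coeff g"
    by (rule hs_coeff_cong[OF holomorphic_H[OF assms(1)]]) (rule assms(2))
  then show ?thesis by (simp add: hs_inner_eq)
qed

section \<open>Reproducing kernels and adjoints of composition operators\<close>

text \<open>This inverts the isometry: on the disc,
  \<open>hs_to_hardy \<tau> q (hs_of_hardy G)\<close> is \<open>G\<close>.\<close>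

definition hs_of_hardy :: "(complex \<Rightarrow> complex) \<Rightarrow> complex \<Rightarrow> complex" where
  "hs_of_hardy G = (\<lambda>w. G (\<sigma> w) / q (\<sigma> w))"

definition hs_monomial :: "nat \<Rightarrow> complex \<Rightarrow> complex" where
  "hs_monomial n = hs_of_hardy (\<lambda>z. z ^ n)"

text \<open>Pairing \<open>hs_to_hardy \<tau> q f\<close> with the Szego kernel at
  \<open>\<sigma> u\<close> returns \<open>f u * q (\<sigma> u)\<close>; the factor
  \<open>1 / cnj (q (\<sigma> u))\<close> removes \<open>q\<close> from this value.\<close>

definition hs_kernel :: "complex \<Rightarrow> complex \<Rightarrow> complex" where
  "hs_kernel u = hs_of_hardy (\<lambda>z. 1 / (cnj (q (\<sigma> u)) * (1 - cnj (\<sigma> u) * z)))"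

lemma holomorphic_hs_of_hardy:
  assumes "G holomorphic_on ball 0 1"
  shows "hs_of_hardy G holomorphic_on \<Omega>"
proof -
  have "((\<lambda>z. G z / q z) \<circ> \<sigma>) holomorphic_on \<Omega>"
    by (rule holomorphic_on_compose_gen[OF holomorphic_\<sigma>, of _ "ball 0 1"])
       (use assms q_nonzero \<sigma>_in in \<open>auto intro!: holomorphic_on_divide holomorphic_q\<close>)
  then show ?thesis by (simp add: hs_of_hardy_def o_def)
qed

lemma hs_coeff_hs_of_hardy:
  assumes "G holomorphic_on ball 0 1"
  shows "hs_coeff (hs_of_hardy G) = maclaurin_coeff G"
  unfolding hs_coeff_def
  by (rule maclaurin_coeff_cong[OF assms])
     (use q_nonzero in \<open>auto simp: hs_to_hardy_def hs_of_hardy_def \<sigma>_\<tau>\<close>)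

lemma hs_coeff_monomial: "hs_coeff (hs_monomial n) = (\<lambda>m. if m = n then 1 else 0)"
proof -
  have "(\<lambda>m. (if m = n then 1 else 0) * z ^ m) sums z ^ n" for z :: complex
    using sums_single[of n "\<lambda>m. z ^ m"] by (simp add: if_distrib[of "\<lambda>x. x * _"] cong: if_cong)
  then show ?thesis
    unfolding hs_monomial_def
    by (subst hs_coeff_hs_of_hardy) (auto intro!: maclaurin_coeff_unique holomorphic_intros)
qed

lemma hs_monomial_in_H: "hs_monomial n \<in> H"
proof -
  have "hs_monomial n holomorphic_on \<Omega>"
    unfolding hs_monomial_def by (intro holomorphic_hs_of_hardy holomorphic_intros)
  moreover have "summable (\<lambda>m. (cmod (hs_coeff (hs_monomial n) m))\<^sup>2)"
    by (rule summable_finite[of "{n}"]) (auto simp: hs_coeff_monomial)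
  ultimately show ?thesis by (simp add: hardy_smirnov_iff)
qed

lemma one_minus_cnj_mult_nonzero:
  assumes "cmod x < 1" "cmod z < 1"
  shows "1 - cnj x * z \<noteq> 0"
proof
  assume "1 - cnj x * z = 0"
  then have "cmod (cnj x * z) = 1" by (metis eq_iff_diff_eq_0 norm_one)
  moreover have "cmod x * cmod z < 1 * 1"
    using assms by (intro mult_strict_mono') auto
  ultimately show False by (simp add: norm_mult)
qed

lemma holomorphic_szego:
  assumes u: "u \<in> \<Omega>"
  shows "(\<lambda>z. 1 / (cnj (q (\<sigma> u)) * (1 - cnj (\<sigma> u) * z))) holomorphic_on ball 0 1"
  using one_minus_cnj_mult_nonzero[OF norm_\<sigma>[OF u]] q_nonzero[OF \<sigma>_in[OF u]]
  by (intro holomorphic_intros) auto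

lemma hs_coeff_kernel:
  assumes u: "u \<in> \<Omega>"
  shows "hs_coeff (hs_kernel u) = (\<lambda>n. cnj (\<sigma> u) ^ n / cnj (q (\<sigma> u)))"
  unfolding hs_kernel_def hs_coeff_hs_of_hardy[OF holomorphic_szego[OF u]]
proof (rule maclaurin_coeff_unique)
  fix z :: complex assume "z \<in> ball 0 1"
  then have "cmod z < 1" by simp
  moreover from norm_\<sigma>[OF u] have "cmod (\<sigma> u) < 1" .
  ultimately have "cmod (\<sigma> u) * cmod z < 1 * 1" by (intro mult_strict_mono') auto
  then have "cmod (cnj (\<sigma> u) * z) < 1" by (simp add: norm_mult)
  from sums_mult[OF geometric_sums[OF this], of "1 / cnj (q (\<sigma> u))"]
  show "(\<lambda>n. cnj (\<sigma> u) ^ n / cnj (q (\<sigma> u)) * z ^ n) sums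
          (1 / (cnj (q (\<sigma> u)) * (1 - cnj (\<sigma> u) * z)))"
    by (simp add: power_mult_distrib)
qed

lemma hs_kernel_in_H:
  assumes u: "u \<in> \<Omega>"
  shows "hs_kernel u \<in> H"
proof -
  have "(cmod (\<sigma> u))\<^sup>2 < 1"
    using norm_\<sigma>[OF u] by (simp add: power_less_one_iff)
  then have "summable (\<lambda>n. ((cmod (\<sigma> u))\<^sup>2) ^ n)" by (intro summable_geometric) simp
  from summable_mult[OF this, of "1 / (cmod (q (\<sigma> u)))\<^sup>2"]
  have "summable (\<lambda>n. (cmod (hs_coeff (hs_kernel u) n))\<^sup>2)"
    by (simp add: hs_coeff_kernel[OF u] norm_divide norm_power power_divide flip: power_mult)
       (simp add: mult.commute)
  then show ?thesis
    using holomorphic_hs_of_hardy[OF holomorphic_szego[OF u]]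
    by (simp add: hardy_smirnov_iff hs_kernel_def)
qed

lemma hs_inner_kernel:
  assumes f: "f \<in> H" and u: "u \<in> \<Omega>"
  shows "hs_inner \<tau> q f (hs_kernel u) = f u"
proof -
  have "(\<lambda>n. hs_coeff f n * \<sigma> u ^ n) sums (f u * q (\<sigma> u))"
    using maclaurin_sums[OF holomorphic_hs_to_hardy[OF holomorphic_H[OF f]] \<sigma>_in[OF u]]
    by (simp add: hs_coeff_def hs_to_hardy_at_\<sigma>[OF u])
  from sums_divide[OF this, of "q (\<sigma> u)"]
  have "(\<lambda>n. hs_coeff f n * cnj (hs_coeff (hs_kernel u) n)) sums f u"
    using q_nonzero[OF \<sigma>_in[OF u]] by (simp add: hs_coeff_kernel[OF u])
  with hs_inner_sums[OF f hs_kernel_in_H[OF u]] show ?thesis by (rule sums_unique2)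
qed

lemma cnj_hs_kernel:
  "cnj (hs_kernel u w) = hs_kernel w u"
  by (simp add: hs_kernel_def hs_of_hardy_def mult_ac)

section \<open>Bounded functionals: monomial expansion and vanishing on kernels\<close>

lemma hs_partial_sum:
  fixes f N
  defines "P \<equiv> \<lambda>w. \<Sum>n<N. hs_coeff f n * hs_monomial n w"
  shows "P \<in> H" "hs_coeff P = (\<lambda>n. if n < N then hs_coeff f n else 0)"
proof -
  let ?P = "\<lambda>N w. \<Sum>n<N. hs_coeff f n * hs_monomial n w"
  have "?P N \<in> H \<and> hs_coeff (?P N) = (\<lambda>n. if n < N then hs_coeff f n else 0)"
  proof (induction N)
    case 0
    show ?case
      using H_cmult[OF hs_monomial_in_H[of 0], of 0]
        hs_coeff_cmult[OF holomorphic_H[OF hs_monomial_in_H[of 0]], of 0] by simp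
  next
    case (Suc N)
    have *: "(\<lambda>w. hs_coeff f N * hs_monomial N w) \<in> H" by (intro H_cmult hs_monomial_in_H)
    have "hs_coeff (?P (Suc N)) = (\<lambda>n. (if n < N then hs_coeff f n else 0) + hs_coeff f N * (if n = N then 1 else 0))"
      using Suc hs_coeff_add[OF holomorphic_H[of "?P N"] holomorphic_H[OF *]]
      by (simp add: hs_coeff_cmult holomorphic_H hs_monomial_in_H hs_coeff_monomial)
    also have "\<dots> = (\<lambda>n. if n < Suc N then hs_coeff f n else 0)"
      by (auto simp: fun_eq_iff less_Suc_eq)
    finally show ?case using H_add[OF _ *, of "?P N"] Suc by simp
  qed
  then show "P \<in> H" "hs_coeff P = (\<lambda>n. if n < N then hs_coeff f n else 0)"
    by (simp_all add: P_def)
qed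

text \<open>The squared norm of the remainder \<open>?R N\<close> is a tail of a convergent series,
  so \<open>f\<close> is the norm limit of its partial sums, and boundedness of \<open>L\<close>
  carries the limit over.\<close>

lemma bounded_functional_sums:
  assumes add: "\<And>f g. f \<in> H \<Longrightarrow> g \<in> H \<Longrightarrow> L (\<lambda>w. f w + g w) = L f + L g"
    and cmult: "\<And>f k. f \<in> H \<Longrightarrow> L (\<lambda>w. k * f w) = k * L f"
    and bound: "\<And>f. f \<in> H \<Longrightarrow> norm (L f) \<le> B * hs_norm \<tau> f"
    and f: "f \<in> H"
  shows "(\<lambda>n. hs_coeff f n * L (hs_monomial n)) sums (L f :: complex)"
proof -
  let ?P = "\<lambda>N w. \<Sum>n<N. hs_coeff f n * hs_monomial n w"
  \<comment> \<open>The difference is written with the factor -1 so that \<open>H_add\<close>,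
    \<open>H_cmult\<close>, \<open>add\<close> and \<open>cmult\<close> apply literally.\<close>
  let ?R = "\<lambda>N w. f w + (-1) * ?P N w"
  let ?t = "\<lambda>n. (cmod (hs_coeff f n))\<^sup>2"
  note P = hs_partial_sum[of f]
  have LP: "L (?P N) = (\<Sum>n<N. hs_coeff f n * L (hs_monomial n))" for N
  proof (induction N)
    case 0
    show ?case using cmult[OF f, of 0] by simp
  next
    case (Suc N)
    then show ?case using add[OF P(1)[of N] H_cmult[OF hs_monomial_in_H[of N], of "hs_coeff f N"]]
      by (simp add: cmult hs_monomial_in_H)
  qed
  have R: "?R N \<in> H" for N by (intro H_add H_cmult P f)
  have "hs_coeff (?R N) = (\<lambda>n. hs_coeff f n + (-1) * hs_coeff (?P N) n)" for N
    by (subst hs_coeff_add[OF holomorphic_H[OF f] holomorphic_H[OF H_cmult[OF P(1)]]],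
        subst hs_coeff_cmult[OF holomorphic_H[OF P(1)]]) rule
  then have cR: "hs_coeff (?R N) = (\<lambda>n. if n < N then 0 else hs_coeff f n)" for N
    by (auto simp: P(2) fun_eq_iff)
  have "hs_norm \<tau> (?R N) = sqrt (suminf ?t - (\<Sum>n<N. ?t n))" for N
  proof -
    have "(\<lambda>n. (cmod (hs_coeff (?R N) n))\<^sup>2) sums (suminf ?t - (\<Sum>n<N. ?t n))"
    proof -
      have "(\<lambda>n. if n \<in> {..<N} then ?t n else 0) sums (\<Sum>n<N. ?t n)"
        by (rule sums_If_finite_set) simp
      from sums_diff[OF summable_sums[OF summable_H[OF f]] this]
      have "(\<lambda>n. ?t n - (if n \<in> {..<N} then ?t n else 0)) sums (suminf ?t - (\<Sum>n<N. ?t n))" .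
      moreover have "(\<lambda>n. (cmod (hs_coeff (?R N) n))\<^sup>2) = (\<lambda>n. ?t n - (if n \<in> {..<N} then ?t n else 0))"
        unfolding cR by auto
      ultimately show ?thesis by (rule ssubst[rotated])
    qed
    then show ?thesis by (simp only: hs_norm_eq[OF R] sums_iff)
  qed
  moreover have "(\<lambda>N. sqrt (suminf ?t - (\<Sum>n<N. ?t n))) \<longlonglongrightarrow> sqrt (suminf ?t - suminf ?t)"
    by (intro tendsto_intros summable_LIMSEQ summable_H f)
  ultimately have "(\<lambda>N. hs_norm \<tau> (?R N)) \<longlonglongrightarrow> 0" by simp
  from tendsto_mult_left[OF this, of B] have lim: "(\<lambda>N. B * hs_norm \<tau> (?R N)) \<longlonglongrightarrow> 0" by simp
  have "norm (L (?P N) - L f) \<le> B * hs_norm \<tau> (?R N)" for N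
  proof -
    have "L (?R N) = L f + (-1) * L (?P N)"
      by (subst add[OF f H_cmult[OF P(1)]], subst cmult[OF P(1)]) rule
    with bound[OF R, of N] show ?thesis by (simp add: norm_minus_commute)
  qed
  then have "(\<lambda>N. L (?P N) - L f) \<longlonglongrightarrow> 0"
    by (intro Lim_null_comparison[OF _ lim] always_eventually) auto
  then have "(\<lambda>N. L (?P N)) \<longlonglongrightarrow> L f" by (rule LIM_zero_cancel)
  then show ?thesis by (simp add: sums_def LP)
qed

text \<open>
  The value of \<open>L\<close> at the kernel of \<open>\<tau> (cnj z)\<close> is, up to a nonzero factor, the power series in \<open>z\<close>
  with coefficients \<open>L (hs_monomial n)\<close>; so these coefficients vanish.
\<close>
lemma bounded_functional_eq_0:
  assumes add: "\<And>f g. f \<in> H \<Longrightarrow> g \<in> H \<Longrightarrow> L (\<lambda>w. f w + g w) = L f + L g"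
    and cmult: "\<And>f k. f \<in> H \<Longrightarrow> L (\<lambda>w. k * f w) = k * L f"
    and bound: "\<And>f. f \<in> H \<Longrightarrow> norm (L f) \<le> B * hs_norm \<tau> f"
    and ker: "\<And>u. u \<in> \<Omega> \<Longrightarrow> L (hs_kernel u) = 0"
    and f: "f \<in> H"
  shows "L f = (0 :: complex)"
proof -
  have sums: "(\<lambda>n. hs_coeff f n * L (hs_monomial n)) sums L f" if "f \<in> H" for f
    by (rule bounded_functional_sums[OF add cmult bound that])
  have "(\<lambda>n. L (hs_monomial n) * z ^ n) sums 0" if z: "z \<in> ball 0 1" for z
  proof -
    define u where "u = \<tau> (cnj z)"
    have z': "cnj z \<in> ball 0 1" using z by simp
    then have u: "u \<in> \<Omega>" "\<sigma> u = cnj z" by (auto simp: u_def \<tau>_in \<sigma>_\<tau>)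
    have "(\<lambda>n. z ^ n / cnj (q (cnj z)) * L (hs_monomial n)) sums 0"
      using sums[OF hs_kernel_in_H[OF u(1)]] by (simp add: hs_coeff_kernel u ker)
    from sums_mult[OF this, of "cnj (q (cnj z))"] show ?thesis
      using q_nonzero[OF z'] by (simp add: mult.commute)
  qed
  then have "maclaurin_coeff (\<lambda>_. 0) = (\<lambda>n. L (hs_monomial n))"
    by (rule maclaurin_coeff_unique)
  moreover have "maclaurin_coeff (\<lambda>_. 0) = (\<lambda>n. 0)"
    by (rule maclaurin_coeff_unique) simp
  ultimately have "L (hs_monomial n) = 0" for n by (metis (no_types))
  then show ?thesis using sums[OF f] sums_unique2[OF _ sums_zero] by simp
qed

text \<open>The scalar is conjugated because it leaves the second, conjugate-linear slot.
  Boundedness of the operators gives membership of the composites, and the norm bound for \<Phi>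
  makes the difference of the two sides of the adjoint identity a bounded functional.\<close>

lemma is_hs_adjoint_composition_iff:
  assumes \<Psi>: "\<Psi> ` \<Omega> \<subseteq> \<Omega>"
    and b\<Phi>: "composition_op_bounded \<tau> \<Omega> \<Phi>" and b\<Psi>: "composition_op_bounded \<tau> \<Omega> \<Psi>"
  shows "is_hs_adjoint \<tau> q \<Omega> (composition_op \<Phi>) (\<lambda>g w. k * composition_op \<Psi> g w) \<longleftrightarrow>
           (\<forall>u\<in>\<Omega>. \<forall>w\<in>\<Omega>. hs_kernel w (\<Phi> u) = cnj k * hs_kernel (\<Psi> w) u)"
proof
  have comp\<Phi>: "f \<circ> \<Phi> \<in> H" and comp\<Psi>: "f \<circ> \<Psi> \<in> H" if "f \<in> H" for f
    using b\<Phi> b\<Psi> that by (auto simp: composition_op_bounded_def composition_op_def)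
  note S = H_cmult[OF comp\<Psi>, of _ k]
  have inner_S: "hs_inner \<tau> q (hs_kernel w) (\<lambda>x. k * (g \<circ> \<Psi>) x) = cnj k * cnj (g (\<Psi> w))"
    if "w \<in> \<Omega>" "g \<in> H" for w g
  proof -
    have "hs_inner \<tau> q (hs_kernel w) (\<lambda>x. k * (g \<circ> \<Psi>) x)
        = cnj (hs_inner \<tau> q (\<lambda>x. k * (g \<circ> \<Psi>) x) (hs_kernel w))"
      by (rule hs_inner_commute[OF S hs_kernel_in_H]) fact+
    then show ?thesis using hs_inner_kernel[OF S[OF that(2)] that(1)] by simp
  qed
  show "\<forall>u\<in>\<Omega>. \<forall>w\<in>\<Omega>. hs_kernel w (\<Phi> u) = cnj k * hs_kernel (\<Psi> w) u"
    if adj: "is_hs_adjoint \<tau> q \<Omega> (composition_op \<Phi>) (\<lambda>g w. k * composition_op \<Psi> g w)"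
  proof (intro ballI)
    fix u w assume u: "u \<in> \<Omega>" and w: "w \<in> \<Omega>"
    \<comment> \<open>The reproducing property evaluates both sides, and
      \<open>cnj_hs_kernel\<close> swaps the arguments of the kernel on the right.\<close>
    have "hs_inner \<tau> q (hs_kernel w \<circ> \<Phi>) (hs_kernel u)
        = hs_inner \<tau> q (hs_kernel w) (\<lambda>x. k * (hs_kernel u \<circ> \<Psi>) x)"
      using adj hs_kernel_in_H[OF u] hs_kernel_in_H[OF w]
      by (simp only: is_hs_adjoint_def composition_op_def)
    then show "hs_kernel w (\<Phi> u) = cnj k * hs_kernel (\<Psi> w) u"
      using hs_inner_kernel[OF comp\<Phi>[OF hs_kernel_in_H[OF w]] u] inner_S[OF w hs_kernel_in_H[OF u]]
      by (simp add: cnj_hs_kernel)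
  qed
  show "is_hs_adjoint \<tau> q \<Omega> (composition_op \<Phi>) (\<lambda>g w. k * composition_op \<Psi> g w)"
    if eq: "\<forall>u\<in>\<Omega>. \<forall>w\<in>\<Omega>. hs_kernel w (\<Phi> u) = cnj k * hs_kernel (\<Psi> w) u"
    unfolding is_hs_adjoint_def composition_op_def
  proof (intro conjI ballI)
    fix f g assume f: "f \<in> H" and g: "g \<in> H"
    show "(\<lambda>w. k * (g \<circ> \<Psi>) w) \<in> H" by (rule S[OF g])
    let ?S = "\<lambda>w. k * (g \<circ> \<Psi>) w"
    \<comment> \<open>For fixed \<open>g\<close> both sides of the adjoint identity are linear in
      \<open>f\<close>; by \<open>bounded_functional_eq_0\<close> their difference need only be
      tested on kernels.\<close>
    define L where "L f = hs_inner \<tau> q (f \<circ> \<Phi>) g + (-1) * hs_inner \<tau> q f ?S" for f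
    obtain B where B: "\<And>f. f \<in> H \<Longrightarrow> hs_norm \<tau> (f \<circ> \<Phi>) \<le> B * hs_norm \<tau> f"
      using b\<Phi> by (auto simp: composition_op_bounded_def composition_op_def)
    have "L f = 0"
    proof (rule bounded_functional_eq_0[OF _ _ _ _ f])
      fix f1 f2 assume H: "f1 \<in> H" "f2 \<in> H"
      show "L (\<lambda>w. f1 w + f2 w) = L f1 + L f2"
        using hs_inner_add_left[OF comp\<Phi>[OF H(1)] comp\<Phi>[OF H(2)] g] hs_inner_add_left[OF H S[OF g]]
        by (simp add: L_def o_def)
    next
      fix f1 c assume H: "f1 \<in> H"
      show "L (\<lambda>w. c * f1 w) = c * L f1"
        using hs_inner_cmult_left[OF comp\<Phi>[OF H] g] hs_inner_cmult_left[OF H S[OF g]]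
        by (simp add: L_def o_def ring_distribs)
    next
      fix f1 assume H: "f1 \<in> H"
      have "norm (L f1) \<le> norm (hs_inner \<tau> q (f1 \<circ> \<Phi>) g) + norm (hs_inner \<tau> q f1 ?S)"
        unfolding L_def by (rule order_trans[OF norm_triangle_ineq]) simp
      also have "\<dots> \<le> hs_norm \<tau> (f1 \<circ> \<Phi>) * hs_norm \<tau> g + hs_norm \<tau> f1 * hs_norm \<tau> ?S"
        by (intro add_mono norm_hs_inner_le comp\<Phi> H g S)
      also have "\<dots> \<le> (B * hs_norm \<tau> f1) * hs_norm \<tau> g + hs_norm \<tau> f1 * hs_norm \<tau> ?S"
        by (intro add_mono mult_right_mono B H hs_norm_nonneg g order_refl)
      also have "\<dots> = (B * hs_norm \<tau> g + hs_norm \<tau> ?S) * hs_norm \<tau> f1" by algebra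
      finally show "norm (L f1) \<le> (B * hs_norm \<tau> g + hs_norm \<tau> ?S) * hs_norm \<tau> f1" .
    next
      fix w assume w: "w \<in> \<Omega>"
      have \<Psi>w: "\<Psi> w \<in> \<Omega>" using \<Psi> w by auto
      \<comment> \<open>By the kernel identity this term equals
        \<open>cnj k * cnj (g (\<Psi> w))\<close>, the value that \<open>inner_S\<close> gives for
        the other term of \<open>L\<close>.\<close>
      have "hs_inner \<tau> q (hs_kernel w \<circ> \<Phi>) g = hs_inner \<tau> q (\<lambda>u. cnj k * hs_kernel (\<Psi> w) u) g"
        using eq w by (intro hs_inner_cong_left H_cmult hs_kernel_in_H \<Psi>w) auto
      also have "\<dots> = cnj k * hs_inner \<tau> q (hs_kernel (\<Psi> w)) g"
        by (intro hs_inner_cmult_left hs_kernel_in_H \<Psi>w g)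
      also have "\<dots> = cnj k * cnj (g (\<Psi> w))"
        using hs_inner_commute[OF g hs_kernel_in_H[OF \<Psi>w]] hs_inner_kernel[OF g \<Psi>w] by simp
      finally show "L (hs_kernel w) = 0" using inner_S[OF w g] by (simp add: L_def)
    qed
    then show "hs_inner \<tau> q (f \<circ> \<Phi>) g = hs_inner \<tau> q f ?S" by (simp add: L_def)
  qed
qed

end

section \<open>The functional equation of a Hermitian form\<close>

text \<open>After a shift by \<open>m = M / C\<close> the equation says that a difference of two
  products, each separated in \<open>u\<close> and \<open>w\<close>, is a constant \<open>E\<close>.
  Two values of \<open>w\<close> force \<open>E = 0\<close>; since \<open>A / C - m * cnj m\<close>
  is (A C - |M|^2) / C^2, this means \<open>k = 1\<close>. What remains separates the variables, and
  the common ratio is \<open>r\<close>.\<close>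

lemma hermitian_form_functional_eq_nonzero:
  fixes \<Phi> \<Psi> :: "complex \<Rightarrow> complex" and S :: "complex set" and A C :: real and M k :: complex
  assumes S: "infinite S" and C: "C \<noteq> 0" and D: "A * C \<noteq> (cmod M)\<^sup>2"
  shows "(\<forall>u\<in>S. \<forall>w\<in>S. A + C * u * cnj (\<Psi> w) + cnj M * u + M * cnj (\<Psi> w) =
             cnj k * (A + C * \<Phi> u * cnj w + cnj M * \<Phi> u + M * cnj w)) \<longleftrightarrow>
         k = 1 \<and> (\<exists>r. \<forall>w\<in>S. \<Phi> w = r * w + (r - 1) * M / C \<and>
                               \<Psi> w = cnj r * w + (cnj r - 1) * M / C)"
    (is "?L \<longleftrightarrow> ?R")
proof -
  \<comment> \<open>Completing the square: the form equals \<open>C * (u + m) * cnj (w + m) + (A - C * |m|\<^sup>2)\<close>.\<close>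
  define m where "m = M / C"
  define E where "E = (cnj k - 1) * (A / C - m * cnj m)"
  have M: "M = C * m" using C by (simp add: m_def)
  have MC: "z * M / C = z * m" for z :: complex using C by (simp add: M)
  have AC: "A / C - m * cnj m \<noteq> 0"
  proof
    assume "A / C - m * cnj m = 0"
    then have "complex_of_real (A * C) = (C * m) * cnj (C * m)"
      using C by (simp add: field_simps)
    also have "\<dots> = of_real ((cmod M)\<^sup>2)" by (simp only: M complex_norm_square)
    finally show False using D by (simp only: of_real_eq_iff)
  qed
  have L: "?L \<longleftrightarrow> (\<forall>u\<in>S. \<forall>w\<in>S. (u + m) * cnj (\<Psi> w + m) - cnj k * (\<Phi> u + m) * cnj (w + m) = E)"
  proof (intro ball_cong refl)
    fix u w :: complex
    let ?l = "A + C * u * cnj (\<Psi> w) + cnj M * u + M * cnj (\<Psi> w)"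
      and ?r = "cnj k * (A + C * \<Phi> u * cnj w + cnj M * \<Phi> u + M * cnj w)"
      and ?d = "(u + m) * cnj (\<Psi> w + m) - cnj k * (\<Phi> u + m) * cnj (w + m)"
    have "?l - ?r = C * (?d - E)"
      using C by (simp add: M E_def field_simps)
    then show "?l = ?r \<longleftrightarrow> ?d = E" using C by auto
  qed
  show ?thesis unfolding L
  proof
    assume *: "\<forall>u\<in>S. \<forall>w\<in>S. (u + m) * cnj (\<Psi> w + m) - cnj k * (\<Phi> u + m) * cnj (w + m) = E"
    \<comment> \<open>An infinite set still has points after -m, and later also \<open>x\<close>, is
      removed. A nonzero \<open>x + m\<close> is needed to form the ratio \<open>r\<close>.\<close>
    obtain x where x: "x \<in> S" "x + m \<noteq> 0"
      using infinite_imp_nonempty[OF Diff_infinite_finite[OF _ S, of "{- m}"]]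
      by (auto simp: add_eq_0_iff2)
    obtain y where y: "y \<in> S" "y + m \<noteq> 0" "x \<noteq> y"
      using infinite_imp_nonempty[OF Diff_infinite_finite[OF _ S, of "{- m, x}"]]
      by (auto simp: add_eq_0_iff2)
    \<comment> \<open>Multiplying the equation for \<open>w = x\<close> by
      \<open>cnj (y + m)\<close>, that for \<open>w = y\<close> by \<open>cnj (x + m)\<close> and
      subtracting eliminates \<open>\<Phi> u\<close>. The resulting right-hand side is independent
      of \<open>u\<close>, so \<open>t\<close> must vanish, and then so must
      \<open>E\<close>.\<close>
    define t where "t = cnj (\<Psi> x + m) * cnj (y + m) - cnj (\<Psi> y + m) * cnj (x + m)"
    have t: "(u + m) * t = E * (cnj (y + m) - cnj (x + m))" if u: "u \<in> S" for u
    proof -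
      have "(u + m) * cnj (\<Psi> x + m) - cnj k * (\<Phi> u + m) * cnj (x + m) = E"
           "(u + m) * cnj (\<Psi> y + m) - cnj k * (\<Phi> u + m) * cnj (y + m) = E"
        using * u x y by blast+
      moreover have "a * p * s' - a * p' * s = e * (s' - s)"
        if "a * p - b * s = e" "a * p' - b * s' = e" for a b e p p' s s' :: complex
      proof -
        have "a * p = e + b * s" "a * p' = e + b * s'" using that by (simp_all add: diff_eq_eq)
        then show ?thesis by (simp only:) (simp add: algebra_simps)
      qed
      ultimately show ?thesis unfolding t_def by (simp only: right_diff_distrib flip: mult.assoc)
    qed
    have "(x + m) * t = (y + m) * t" by (simp only: t x y)
    then have "(x - y) * t = 0" by (simp add: algebra_simps)
    with y have "t = 0" by simp
    with t[OF x(1)] y have E: "E = 0" by auto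
    with AC have "cnj k = 1" by (simp add: E_def)
    then have k1: "k = 1" by (metis complex_cnj_cnj complex_cnj_one)
    define r where "r = (\<Phi> x + m) / (x + m)"
    \<comment> \<open>Setting \<open>u = x\<close> determines \<Psi> first; its value at
      \<open>x\<close> then enters the equation with \<open>w = x\<close>, which determines
      \<Phi>.\<close>
    have \<Psi>: "\<Psi> w + m = cnj r * (w + m)" if "w \<in> S" for w
    proof -
      have "(x + m) * cnj (\<Psi> w + m) = (\<Phi> x + m) * cnj (w + m)"
        using * x that k1 E by fastforce
      then have "cnj (\<Psi> w + m) = r * cnj (w + m)" using x by (simp add: r_def field_simps)
      then have "cnj (cnj (\<Psi> w + m)) = cnj (r * cnj (w + m))" by (rule arg_cong)
      then show ?thesis by (simp only: complex_cnj_cnj complex_cnj_mult)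
    qed
    have \<Phi>: "\<Phi> w + m = r * (w + m)" if "w \<in> S" for w
    proof -
      have "(w + m) * cnj (\<Psi> x + m) = (\<Phi> w + m) * cnj (x + m)"
        using * x that k1 E by fastforce
      then have "(w + m) * (r * cnj (x + m)) = (\<Phi> w + m) * cnj (x + m)"
        unfolding \<Psi>[OF x(1)] by simp
      moreover have "cnj (x + m) \<noteq> 0" using x by (simp only: complex_cnj_zero_iff) simp
      ultimately show ?thesis by (metis mult.assoc mult.commute mult_right_cancel)
    qed
    show ?R
    proof (intro conjI k1 exI[of _ r] ballI)
      fix w assume "w \<in> S"
      from \<Phi>[OF this] show "\<Phi> w = r * w + (r - 1) * M / C"
        unfolding MC by (simp add: algebra_simps)
      from \<Psi>[OF \<open>w \<in> S\<close>] show "\<Psi> w = cnj r * w + (cnj r - 1) * M / C"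
        unfolding MC by (simp add: algebra_simps)
    qed
  next
    assume ?R
    then obtain r where k1: "k = 1" and r: "\<And>w. w \<in> S \<Longrightarrow> \<Phi> w = r * w + (r - 1) * M / C"
      "\<And>w. w \<in> S \<Longrightarrow> \<Psi> w = cnj r * w + (cnj r - 1) * M / C" by blast
    show "\<forall>u\<in>S. \<forall>w\<in>S. (u + m) * cnj (\<Psi> w + m) - cnj k * (\<Phi> u + m) * cnj (w + m) = E"
    proof (intro ballI)
      fix u w assume "u \<in> S" "w \<in> S"
      then have "\<Phi> u + m = r * (u + m)" "\<Psi> w + m = cnj r * (w + m)"
        by (simp_all add: algebra_simps r[unfolded MC])
      then show "(u + m) * cnj (\<Psi> w + m) - cnj k * (\<Phi> u + m) * cnj (w + m) = E"
        by (simp add: k1 E_def)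
    qed
  qed
qed

text \<open>This is the case \<open>C = 0\<close>: without the product term, \<open>u\<close> and
  \<open>w\<close> occur in separate summands. The slopes are therefore fixed by \<open>k\<close>,
  while \<open>A\<close> is absorbed into the constant term of \<Psi>, so \<open>k\<close> stays
  free.\<close>

lemma hermitian_form_functional_eq_zero:
  fixes \<Phi> \<Psi> :: "complex \<Rightarrow> complex" and S :: "complex set" and A :: real and M k :: complex
  assumes S: "S \<noteq> {}" and M: "M \<noteq> 0" and k: "k \<noteq> 0"
  shows "(\<forall>u\<in>S. \<forall>w\<in>S. A + cnj M * u + M * cnj (\<Psi> w) = cnj k * (A + cnj M * \<Phi> u + M * cnj w)) \<longleftrightarrow>
         (\<exists>r. \<forall>w\<in>S. \<Phi> w = inverse (cnj k) * w + r \<and>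
                     \<Psi> w = k * w + ((k - 1) * A + k * cnj r * M) / cnj M)"
    (is "?L \<longleftrightarrow> ?R")
proof
  assume *: ?L
  obtain x where x: "x \<in> S" using S by blast
  define r where "r = \<Phi> x - inverse (cnj k) * x"
  have \<Phi>: "\<Phi> u = inverse (cnj k) * u + r" if u: "u \<in> S" for u
  proof -
    \<comment> \<open>Subtracting the equation at \<open>(x, x)\<close> from that at
      \<open>(u, x)\<close> cancels every term in the second variable.\<close>
    have "cnj M * (u - x) = cnj M * (cnj k * (\<Phi> u - \<Phi> x))"
      using *[rule_format, OF u x] *[rule_format, OF x x] by algebra
    then have "u - x = cnj k * (\<Phi> u - \<Phi> x)" using M by simp
    then show ?thesis using k by (simp add: r_def field_simps)
  qed
  have "\<Psi> w = k * w + ((k - 1) * A + k * cnj r * M) / cnj M" if w: "w \<in> S" for w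
  proof -
    have "cnj k * \<Phi> x = x + cnj k * r" using k by (simp add: \<Phi>[OF x] field_simps)
    with *[rule_format, OF x w] have "M * cnj (\<Psi> w) = cnj k * (A + cnj M * r + M * cnj w) - A"
      by algebra
    then have "cnj (M * cnj (\<Psi> w)) = cnj (cnj k * (A + cnj M * r + M * cnj w) - A)"
      by (rule arg_cong)
    then show ?thesis using M by (simp add: field_simps)
  qed
  with \<Phi> show ?R by blast
next
  assume ?R
  then obtain r where r: "\<And>w. w \<in> S \<Longrightarrow> \<Phi> w = inverse (cnj k) * w + r"
      "\<And>w. w \<in> S \<Longrightarrow> \<Psi> w = k * w + ((k - 1) * A + k * cnj r * M) / cnj M" by blast
  show ?L
  proof (intro ballI)
    fix u w assume "u \<in> S" "w \<in> S"
    then show "A + cnj M * u + M * cnj (\<Psi> w) = cnj k * (A + cnj M * \<Phi> u + M * cnj w)"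
      using M k by (simp add: r field_simps)
  qed
qed

text \<open>The matrix of the form is congruent to diag(1, -1) through a matrix of determinant
  \<open>a * d - b * c\<close>, so its determinant is minus the squared modulus of that
  number.\<close>

lemma hermitian_form_discriminant:
  fixes a b c d :: complex
  shows "((cmod a)\<^sup>2 - (cmod b)\<^sup>2) * ((cmod c)\<^sup>2 - (cmod d)\<^sup>2) =
         (cmod (b * cnj d - a * cnj c))\<^sup>2 - (cmod (a * d - b * c))\<^sup>2"
proof -
  have "complex_of_real (((cmod a)\<^sup>2 - (cmod b)\<^sup>2) * ((cmod c)\<^sup>2 - (cmod d)\<^sup>2)) =
        complex_of_real ((cmod (b * cnj d - a * cnj c))\<^sup>2 - (cmod (a * d - b * c))\<^sup>2)"
    by (simp only: of_real_mult of_real_diff complex_norm_square complex_cnj_diff complex_cnj_mult complex_cnj_cnj)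
       algebra
  then show ?thesis by (simp only: of_real_eq_iff)
qed

section \<open>Linear fractional Riemann maps\<close>

lemma infinite_riemann_domain:
  assumes "riemann_map \<tau> \<Omega>"
  shows "infinite \<Omega>"
proof -
  have "infinite (ball (0::complex) 1)"
    using finite_imp_not_open[of "ball (0::complex) 1"] by auto
  then show ?thesis
    using assms bij_betw_finite by (auto simp: riemann_map_def)
qed

text \<open>The product form of the statement also shows that the Hermitian form has no zero on
  \<Omega> x \<Omega>, which is what allows denominators to be cleared in the theorem.\<close>

lemma (in hardy_smirnov_space) hs_kernel_linear_fractional:
  assumes lf: "linear_fractional_riemann_map \<tau> \<Omega> a b c d"
  obtains \<delta> where "\<delta> \<noteq> 0"
    "\<And>u w. u \<in> \<Omega> \<Longrightarrow> w \<in> \<Omega> \<Longrightarrow>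
       hs_kernel u w * (of_real ((cmod a)\<^sup>2 - (cmod b)\<^sup>2) + of_real ((cmod c)\<^sup>2 - (cmod d)\<^sup>2) * w * cnj u
         + cnj (b * cnj d - a * cnj c) * w + (b * cnj d - a * cnj c) * cnj u) = \<delta>"
proof -
  define \<Delta> where "\<Delta> = a * d - b * c"
  have \<Delta>: "\<Delta> \<noteq> 0" and nz: "\<And>z. z \<in> ball 0 1 \<Longrightarrow> c * z + d \<noteq> 0"
    and \<tau>: "\<And>z. z \<in> ball 0 1 \<Longrightarrow> \<tau> z = (a * z + b) / (c * z + d)"
    using lf by (auto simp: linear_fractional_riemann_map_def \<Delta>_def)
  have deriv: "deriv \<tau> z = \<Delta> / (c * z + d)\<^sup>2" if z: "z \<in> ball 0 1" for z
  proof -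
    have "((\<lambda>z. (a * z + b) / (c * z + d)) has_field_derivative \<Delta> / (c * z + d)\<^sup>2) (at z)"
      using nz[OF z] by (auto intro!: derivative_eq_intros simp: \<Delta>_def power2_eq_square algebra_simps)
    then have "(\<tau> has_field_derivative \<Delta> / (c * z + d)\<^sup>2) (at z)"
      by (rule has_field_derivative_transform_within_open[OF _ open_ball z]) (simp add: \<tau>)
    then show ?thesis by (rule DERIV_imp_deriv)
  qed
  \<comment> \<open>Since q^2 is \<Delta> / (c z + d)^2, the square of \<open>p\<close> is the
    constant \<Delta>. A continuous function with at most two values on the connected disc is
    constant.\<close>
  define p where "p z = q z * (c * z + d)" for z
  have p2: "p z ^ 2 = \<Delta>" if "z \<in> ball 0 1" for z
    using nz[OF that] by (simp add: p_def power_mult_distrib q_square[OF that] deriv[OF that])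
  have "p constant_on ball 0 1"
  proof (rule continuous_finite_range_constant)
    show "connected (ball (0::complex) 1)" by simp
    show "continuous_on (ball 0 1) p" unfolding p_def
      by (intro continuous_intros holomorphic_on_imp_continuous_on holomorphic_q)
    have "p ` ball 0 1 \<subseteq> {csqrt \<Delta>, - csqrt \<Delta>}"
    proof (rule image_subsetI)
      fix z :: complex assume "z \<in> ball 0 1"
      then show "p z \<in> {csqrt \<Delta>, - csqrt \<Delta>}" using p2[of z] power2_eq_iff[of "p z" "csqrt \<Delta>"] by simp
    qed
    then show "finite (p ` ball 0 1)" by (rule finite_subset) simp
  qed
  then obtain \<omega> where \<omega>: "\<And>z. z \<in> ball 0 1 \<Longrightarrow> p z = \<omega>" by (auto simp: constant_on_def)
  have \<omega>2: "\<omega>\<^sup>2 = \<Delta>" using p2[of 0] \<omega>[of 0] by simp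
  with \<Delta> have \<omega>0: "\<omega> \<noteq> 0" by auto
  show thesis
  \<comment> \<open>Passing to the other branch replaces \<omega> by its negative and leaves this
    product unchanged.\<close>
  proof (rule that[of "\<omega> * cnj \<omega>"])
    show "\<omega> * cnj \<omega> \<noteq> 0" using \<omega>0 by simp
    fix u w assume u: "u \<in> \<Omega>" and w: "w \<in> \<Omega>"
    define x y X Y where "x = \<sigma> w" and "y = \<sigma> u" and "X = c * x + d" and "Y = c * y + d"
    have in_ball: "x \<in> ball 0 1" "y \<in> ball 0 1" using \<sigma>_in u w by (auto simp: x_def y_def)
    have X: "X \<noteq> 0" and Y: "Y \<noteq> 0" using nz in_ball by (auto simp: X_def Y_def)
    have wx: "w * X = a * x + b" and uy: "u * Y = a * y + b"
      using \<tau>[OF in_ball(1)] \<tau>[OF in_ball(2)] \<tau>_\<sigma>[OF w] \<tau>_\<sigma>[OF u] X Y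
      by (simp_all add: x_def y_def X_def Y_def nonzero_eq_divide_eq)
    have qx: "q x = \<omega> / X" and qy: "q y = \<omega> / Y"
      using \<omega>[OF in_ball(1)] \<omega>[OF in_ball(2)] X Y
      by (simp_all add: p_def X_def Y_def nonzero_eq_divide_eq)
    have one: "1 - cnj y * x \<noteq> 0" using in_ball by (intro one_minus_cnj_mult_nonzero) auto
    let ?Q = "of_real ((cmod a)\<^sup>2 - (cmod b)\<^sup>2) + of_real ((cmod c)\<^sup>2 - (cmod d)\<^sup>2) * w * cnj u
         + cnj (b * cnj d - a * cnj c) * w + (b * cnj d - a * cnj c) * cnj u"
    \<comment> \<open>This is the diagonal shape of the form. Its entries are the denominator and
      numerator of the inverse map (d w - b) / (a - c w); at \<open>w = \<tau> x\<close> they become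
      \<Delta> / X and \<Delta> x / X, which brings out the Szego factor
      \<open>1 - cnj y * x\<close>.\<close>
    have "?Q = (a - c * w) * cnj (a - c * u) - (d * w - b) * cnj (d * u - b)"
      by (simp only: of_real_mult of_real_diff complex_norm_square complex_cnj_diff complex_cnj_mult complex_cnj_cnj)
         algebra
    moreover have "(a - c * w) * X = \<Delta>" "(d * w - b) * X = \<Delta> * x"
      using wx unfolding \<Delta>_def X_def by algebra+
    then have "a - c * w = \<Delta> / X" "d * w - b = \<Delta> * x / X"
      using X by (simp_all add: nonzero_eq_divide_eq)
    moreover have "(a - c * u) * Y = \<Delta>" "(d * u - b) * Y = \<Delta> * y"
      using uy unfolding \<Delta>_def Y_def by algebra+
    then have "a - c * u = \<Delta> / Y" "d * u - b = \<Delta> * y / Y"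
      using Y by (simp_all add: nonzero_eq_divide_eq)
    ultimately have "?Q = \<Delta> / X * cnj (\<Delta> / Y) - \<Delta> * x / X * cnj (\<Delta> * y / Y)"
      by (simp only:)
    also have "\<dots> = \<Delta> * cnj \<Delta> * (1 - cnj y * x) / (X * cnj Y)"
      by (simp add: diff_divide_distrib algebra_simps)
    finally have Q: "?Q = \<Delta> * cnj \<Delta> * (1 - cnj y * x) / (X * cnj Y)" .
    have "hs_kernel u w = X * cnj Y / (\<omega> * cnj \<omega> * (1 - cnj y * x))"
      unfolding hs_kernel_def hs_of_hardy_def x_def[symmetric] y_def[symmetric] qx qy
      by (simp add: mult_ac)
    with Q have "hs_kernel u w * ?Q = (X * cnj Y / (\<omega> * cnj \<omega> * (1 - cnj y * x))) *
        (\<omega>\<^sup>2 * cnj (\<omega>\<^sup>2) * (1 - cnj y * x) / (X * cnj Y))"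
      by (simp only: \<omega>2)
    also have "\<dots> = \<omega> * cnj \<omega>"
      using X Y \<omega>0 one by (simp add: power2_eq_square)
    finally show "hs_kernel u w * ?Q = \<omega> * cnj \<omega>" .
  qed
qed

theorem theorem4p2:
  fixes \<tau> q \<Phi> \<Phi>s :: "complex \<Rightarrow> complex"
    and \<Omega> :: "complex set"
    and a b c d lam :: complex
  assumes "open \<Omega>" and "simply_connected \<Omega>" and "\<Omega> \<noteq> UNIV"
    and "linear_fractional_riemann_map \<tau> \<Omega> a b c d"
    and "sqrt_deriv_branch \<tau> q"
    and "lam \<noteq> 0"
    and "\<Phi> holomorphic_on \<Omega>" and "\<Phi> ` \<Omega> \<subseteq> \<Omega>"
    and "\<Phi>s holomorphic_on \<Omega>" and "\<Phi>s ` \<Omega> \<subseteq> \<Omega>"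
    and "composition_op_bounded \<tau> \<Omega> \<Phi>"
    and "composition_op_bounded \<tau> \<Omega> \<Phi>s"
  shows "is_hs_adjoint \<tau> q \<Omega> (composition_op \<Phi>) (\<lambda>g w. lam * composition_op \<Phi>s g w) \<longleftrightarrow>
     ((cmod c)\<^sup>2 = (cmod d)\<^sup>2 \<and>
       (\<exists>r. \<forall>w\<in>\<Omega>.
          \<Phi> w = inverse (cnj lam) * w + r \<and>
          \<Phi>s w = lam * w +
            ((lam - 1) * of_real ((cmod a)\<^sup>2 - (cmod b)\<^sup>2) + lam * cnj r * (b * cnj d - a * cnj c))
              / (cnj b * d - cnj a * c))) \<or>
     ((cmod c)\<^sup>2 \<noteq> (cmod d)\<^sup>2 \<and>
       ((cmod a)\<^sup>2 - (cmod b)\<^sup>2) * ((cmod c)\<^sup>2 - (cmod d)\<^sup>2) = (cmod (b * cnj d - a * cnj c))\<^sup>2 \<and>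
       (\<exists>r. \<forall>w\<in>\<Omega>.
          \<Phi> w = r * w +
            (r - 1) * (b * cnj d - a * cnj c) / of_real ((cmod c)\<^sup>2 - (cmod d)\<^sup>2) \<and>
          \<Phi>s w = lam * cnj r * w +
            (lam * cnj r - 1) * (b * cnj d - a * cnj c) / of_real ((cmod c)\<^sup>2 - (cmod d)\<^sup>2))) \<or>
     ((cmod c)\<^sup>2 \<noteq> (cmod d)\<^sup>2 \<and>
       ((cmod a)\<^sup>2 - (cmod b)\<^sup>2) * ((cmod c)\<^sup>2 - (cmod d)\<^sup>2) \<noteq> (cmod (b * cnj d - a * cnj c))\<^sup>2 \<and>
       lam = 1 \<and>
       (\<exists>r. \<forall>w\<in>\<Omega>.
          \<Phi> w = r * w +
            (r - 1) * (b * cnj d - a * cnj c) / of_real ((cmod c)\<^sup>2 - (cmod d)\<^sup>2) \<and>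
          \<Phi>s w = cnj r * w +
            (cnj r - 1) * (b * cnj d - a * cnj c) / of_real ((cmod c)\<^sup>2 - (cmod d)\<^sup>2)))"
proof -
  have riemann: "riemann_map \<tau> \<Omega>" and \<Delta>: "a * d - b * c \<noteq> 0"
    using assms(4) by (auto simp: linear_fractional_riemann_map_def)
  interpret hardy_smirnov_space \<tau> q \<Omega>
    using riemann assms(5) by unfold_locales
  define A C M where "A = (cmod a)\<^sup>2 - (cmod b)\<^sup>2" and "C = (cmod c)\<^sup>2 - (cmod d)\<^sup>2"
    and "M = b * cnj d - a * cnj c"
  define Q where "Q w u = A + C * w * cnj u + cnj M * w + M * cnj u" for w u :: complex
  have D: "A * C \<noteq> (cmod M)\<^sup>2"
    using hermitian_form_discriminant[of a b c d] \<Delta> by (simp add: A_def C_def M_def)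
  have cnjM: "cnj b * d - cnj a * c = cnj M" by (simp add: M_def)
  have C0: "(cmod c)\<^sup>2 = (cmod d)\<^sup>2 \<longleftrightarrow> C = 0" by (simp add: C_def)
  obtain \<delta> where \<delta>: "\<delta> \<noteq> 0" and K: "\<And>u w. u \<in> \<Omega> \<Longrightarrow> w \<in> \<Omega> \<Longrightarrow> hs_kernel u w * Q w u = \<delta>"
    by (rule hs_kernel_linear_fractional[OF assms(4), folded A_def C_def M_def, folded Q_def]) (rule that)
  have "is_hs_adjoint \<tau> q \<Omega> (composition_op \<Phi>) (\<lambda>g w. lam * composition_op \<Phi>s g w) \<longleftrightarrow>
      (\<forall>u\<in>\<Omega>. \<forall>w\<in>\<Omega>. hs_kernel w (\<Phi> u) = cnj lam * hs_kernel (\<Phi>s w) u)"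
    by (rule is_hs_adjoint_composition_iff) fact+
  \<comment> \<open>Each kernel is \<delta> divided by the form, so clearing denominators moves each
    form to the opposite side.\<close>
  also have "\<dots> \<longleftrightarrow> (\<forall>u\<in>\<Omega>. \<forall>w\<in>\<Omega>. Q u (\<Phi>s w) = cnj lam * Q (\<Phi> u) w)"
  proof (intro ball_cong refl)
    fix u w assume u: "u \<in> \<Omega>" and w: "w \<in> \<Omega>"
    have 1: "hs_kernel w (\<Phi> u) * Q (\<Phi> u) w = \<delta>" and 2: "hs_kernel (\<Phi>s w) u * Q u (\<Phi>s w) = \<delta>"
      using K u w assms(8,10) by blast+
    then have nz: "Q (\<Phi> u) w \<noteq> 0" "Q u (\<Phi>s w) \<noteq> 0" using \<delta> by auto
    have "hs_kernel w (\<Phi> u) = \<delta> / Q (\<Phi> u) w" "hs_kernel (\<Phi>s w) u = \<delta> / Q u (\<Phi>s w)"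
      using 1 2 by (simp_all only: nonzero_eq_divide_eq[OF nz(1)] nonzero_eq_divide_eq[OF nz(2)])
    then show "hs_kernel w (\<Phi> u) = cnj lam * hs_kernel (\<Phi>s w) u \<longleftrightarrow> Q u (\<Phi>s w) = cnj lam * Q (\<Phi> u) w"
      by (simp only:) (use \<delta> nz in \<open>simp add: divide_simps mult_ac\<close>)
  qed
  also have "\<dots> \<longleftrightarrow>
     (C = 0 \<and> (\<exists>r. \<forall>w\<in>\<Omega>. \<Phi> w = inverse (cnj lam) * w + r \<and>
          \<Phi>s w = lam * w + ((lam - 1) * A + lam * cnj r * M) / cnj M)) \<or>
     (C \<noteq> 0 \<and> lam = 1 \<and> (\<exists>r. \<forall>w\<in>\<Omega>. \<Phi> w = r * w + (r - 1) * M / C \<and>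
          \<Phi>s w = cnj r * w + (cnj r - 1) * M / C))"
  proof (cases "C = 0")
    case True
    \<comment> \<open>With \<open>C = 0\<close> the inequality \<open>D\<close> reads 0 \<noteq>
      |M|^2.\<close>
    then have "M \<noteq> 0" using D by auto
    with True show ?thesis
      using hermitian_form_functional_eq_zero[of \<Omega> M lam A \<Phi>s \<Phi>] assms(6)
        infinite_imp_nonempty[OF infinite_riemann_domain[OF riemann]]
      by (simp add: Q_def)
  next
    case False
    then show ?thesis
      using hermitian_form_functional_eq_nonzero[OF infinite_riemann_domain[OF riemann] False D, of \<Phi>s lam \<Phi>]
      by (simp add: Q_def)
  qed
  finally show ?thesis
    \<comment> \<open>The equation required in case (2) contradicts \<open>D\<close>, and the
      inequation required in case (3) is \<open>D\<close> itself.\<close>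
    unfolding cnjM C0 unfolding A_def[symmetric] C_def[symmetric] M_def[symmetric]
    using D by (simp only: simp_thms)
qed

end
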